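(* Let $a,N$ be positive integers and let $b=\gcd(a,N)\neq 1$. Write $N=aq+r$ with integers $q\ge 0$ and $0\le r<a$. Define $\alpha=(\alpha_1,\dots,\alpha_a)\in\mathbb{Z}^a$ by $$\alpha_i=\#\left\{k\in\{1,\dots,N-1\} : \left\lceil\frac{ak}{N}\right\rceil=i,\ N\nmid ak\right\}.$$ Then the vector $\alpha$ is unimodal if and only if $r=0$ or $r=b$.
   Context: A vector is unimodal if its entries weakly increase up to some index and weakly decrease afterwards. *)

theory Defs
  imports Complex_Main
begin

(* A vector (v_1, ..., v_n) is represented by a function on nat of which only the
   values at 1, ..., n matter. *)
definition unimodal :: "nat \<Rightarrow> (nat \<Rightarrow> int) \<Rightarrow> bool" where
  "unimodal n v \<longleftrightarrow> (\<exists>m\<in>{1..n}. mono_on {1..m} v \<and> antimono_on {m..n} v)"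

definition alpha :: "nat \<Rightarrow> nat \<Rightarrow> nat \<Rightarrow> int" where
  "alpha a N i =
     int (card {k \<in> {1..N - 1}. \<lceil>real (a * k) / real N\<rceil> = int i \<and> \<not> N dvd a * k})"

end

theory Submission
  imports Defs
begin

text \<open>
  Write \<open>a = b c\<close> and \<open>r = b s\<close>. Counting multiples of \<open>a\<close> strictly between \<open>(i - 1) N\<close> and \<open>i N\<close>
  shows that \<open>\<alpha>\<^sub>i\<close> is periodic in \<open>i\<close> with period \<open>c\<close>, and that it is constant for \<open>s \<le> 1\<close>.
  If \<open>s \<ge> 2\<close>, then \<open>\<alpha>\<^sub>c = q\<close>, whereas \<open>\<alpha>\<^sub>i > q\<close> at \<open>i = \<lfloor>c / s\<rfloor> + 1 \<le> c\<close>. Since \<open>b \<ge> 2\<close>, the index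
  \<open>i + c\<close> is also at most \<open>a\<close>, so \<open>\<alpha>\<close> has a valley at \<open>c\<close>.
\<close>

lemma unimodal_constant:
  assumes "n > 0" and "\<And>i. i \<in> {1..n} \<Longrightarrow> v i = x"
  shows "unimodal n v"
  unfolding unimodal_def
  by (rule bexI[of _ 1]) (use assms in \<open>auto simp: monotone_on_def\<close>)

text \<open>The peak lies on one side of \<open>j\<close>: if \<open>j \<le> m\<close>, the values
  rise from \<open>i\<close> to \<open>j\<close>, otherwise they fall from \<open>j\<close> to
  \<open>k\<close>.\<close>

lemma unimodal_no_valley:
  assumes "unimodal n v" and "1 \<le> i" "i \<le> j" "j \<le> k" "k \<le> n"
  shows "v i \<le> v j \<or> v k \<le> v j"
proof -
  obtain m where m: "mono_on {1..m} v" "antimono_on {m..n} v"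
    using assms(1) unfolding unimodal_def by blast
  show ?thesis
  proof (cases "j \<le> m")
    case True
    then show ?thesis using m(1) assms by (auto simp: monotone_on_def)
  next
    case False
    then show ?thesis using m(2) assms by (auto simp: monotone_on_def)
  qed
qed

text \<open>The ceiling condition means \<open>(i - 1) * N < a * k \<le> i * N\<close>, and
  non-divisibility removes exactly the right endpoint, whence the \<open>- 1\<close>. The range
  \<open>1 \<le> k < N\<close> is then automatic because \<open>i \<le> a\<close>.\<close>

lemma alpha_eq_div:
  fixes a N i :: nat
  assumes "a > 0" "N > 0" "i \<in> {1..a}"
  shows "alpha a N i = int ((i * N - 1) div a) - int (((i - 1) * N) div a)"
proof -
  have "(\<lceil>real (a * k) / real N\<rceil> = int i \<and> \<not> N dvd a * k) \<longleftrightarrow>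
          (i - 1) * N < a * k \<and> a * k < i * N" for k
  proof -
    have "\<lceil>real (a * k) / real N\<rceil> = int i \<longleftrightarrow>
            (real i - 1) * real N < real (a * k) \<and> real (a * k) \<le> real i * real N"
      using assms(2) by (simp add: ceiling_eq_iff pos_less_divide_eq pos_divide_le_eq)
    also have "\<dots> \<longleftrightarrow> (i - 1) * N < a * k \<and> a * k \<le> i * N"
    proof -
      have "(real i - 1) * real N = real ((i - 1) * N)"
        using assms(3) by (simp add: of_nat_diff)
      then show ?thesis by (metis of_nat_le_iff of_nat_less_iff of_nat_mult)
    qed
    finally have *: "\<lceil>real (a * k) / real N\<rceil> = int i \<longleftrightarrow>
            (i - 1) * N < a * k \<and> a * k \<le> i * N" .
    have "\<not> N dvd a * k" if "(i - 1) * N < a * k" "a * k < i * N"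
    proof
      assume "N dvd a * k"
      then obtain t where t: "a * k = t * N" by (metis dvd_def mult.commute)
      have "i - 1 < t" "t < i" using that assms(2) unfolding t by simp_all
      then show False by linarith
    qed
    with * show ?thesis by (metis dvd_triv_right le_neq_implies_less less_imp_le)
  qed
  then have "{k \<in> {1..N - 1}. \<lceil>real (a * k) / real N\<rceil> = int i \<and> \<not> N dvd a * k} =
        {k \<in> {1..N - 1}. (i - 1) * N < a * k \<and> a * k < i * N}"
    by blast
  also have "\<dots> = {((i - 1) * N) div a <.. (i * N - 1) div a}"
  proof -
    have low: "(i - 1) * N < a * k \<longleftrightarrow> ((i - 1) * N) div a < k" for k
      using assms(1) by (simp add: div_less_iff_less_mult mult.commute)
    have up: "a * k < i * N \<longleftrightarrow> k \<le> (i * N - 1) div a" for k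
    proof -
      have "0 < i * N" using assms by simp
      then have "a * k < i * N \<longleftrightarrow> k * a \<le> i * N - 1"
        using mult.commute[of a k] by linarith
      then show ?thesis using assms(1) by (simp add: less_eq_div_iff_mult_less_eq)
    qed
    have "k \<in> {1..N - 1}" if "(i - 1) * N < a * k" "a * k < i * N" for k
    proof -
      have "i * N \<le> a * N" using assms(3) by simp
      then have "a * k < a * N" using that(2) by linarith
      then have "k < N" by simp
      moreover have "k > 0" using that(1) by (cases k) auto
      ultimately show ?thesis by simp
    qed
    then show ?thesis unfolding low up by auto
  qed
  finally have "alpha a N i = int ((i * N - 1) div a - ((i - 1) * N) div a)"
    by (simp add: alpha_def)
  moreover have "((i - 1) * N) div a \<le> (i * N - 1) div a"
  proof (rule div_le_mono)
    have "(i - 1) * N + N = i * N" using assms(3) by (cases i) auto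
    then show "(i - 1) * N \<le> i * N - 1" using assms(2) by linarith
  qed
  ultimately show ?thesis by (simp add: of_nat_diff)
qed

text \<open>Divide by \<open>b\<close> first: for \<open>x > 0\<close>, the number
  \<open>b * x - 1\<close> has quotient \<open>x - 1\<close> and remainder \<open>b - 1\<close>. For
  \<open>x = 0\<close> truncated subtraction makes both sides zero.\<close>

lemma mult_pred_div_mult:
  fixes b c x :: nat
  assumes "b > 0"
  shows "(b * x - 1) div (b * c) = (x - 1) div c"
proof (cases x)
  case (Suc y)
  have "b * x - 1 = (b - 1) + y * b" using assms Suc by (simp add: algebra_simps)
  then have "(b * x - 1) div b = y"
    using assms by (simp only: div_mult_self1) simp
  then show ?thesis using Suc by (simp add: div_mult2_eq)
qed simp

theorem corollary3p7:
  fixes a N b q r :: nat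
  assumes "a > 0" and "N > 0"
    and "b = gcd a N" and "b \<noteq> 1"
    and "N = a * q + r" and "r < a"
  shows "unimodal a (alpha a N) \<longleftrightarrow> r = 0 \<or> r = b"
proof -
  have b: "b = gcd a r" using assms(3,5) gcd_add_mult[of a q r] by (simp add: mult.commute)
  have "b > 0" using assms(1,3) by simp
  with assms(4) have "b \<ge> 2" by simp
  from b obtain c s where c: "a = b * c" and s: "r = b * s"
    by (metis dvd_def gcd_dvd1 gcd_dvd2)
  have "c > 0" "s < c" using c s assms(1,6) by simp_all
  have "coprime c s"
  proof -
    have "b * gcd c s = b" using b gcd_mult_distrib_nat[of b c s] c s by metis
    then show ?thesis using \<open>b > 0\<close> by (simp add: coprime_iff_gcd_eq_1)
  qed
  \<comment> \<open>For \<open>s > 0\<close> this is the number of multiples of \<open>c\<close>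
    strictly between \<open>(i - 1) * s\<close> and \<open>i * s\<close>: the factor
    \<open>b\<close> has been cancelled from \<open>a\<close> and \<open>r\<close>.\<close>
  define \<beta> where "\<beta> i = int ((i * s - 1) div c) - int (((i - 1) * s) div c)" for i
  \<comment> \<open>At \<open>s = 0\<close> the truncated \<open>i * r - 1\<close> would be 0 and
    the value off by one, so \<open>r = 0\<close> is treated separately.\<close>
  have alpha: "alpha a N i = int q + \<beta> i" if i: "i \<in> {1..a}" and "s > 0" for i
  proof -
    have "i * N - 1 = (i * r - 1) + i * q * a"
    proof -
      have "i * r > 0" using i s \<open>s > 0\<close> \<open>b > 0\<close> by simp
      then show ?thesis using assms(5) by (simp add: algebra_simps)
    qed
    then have "(i * N - 1) div a = i * q + (i * r - 1) div a"
      using assms(1) by (simp only: div_mult_self1)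
    also have "(i * r - 1) div a = (i * s - 1) div c"
      using mult_pred_div_mult[OF \<open>b > 0\<close>, of "i * s" c] by (simp add: c s mult.left_commute)
    finally have 1: "(i * N - 1) div a = i * q + (i * s - 1) div c" .
    have "(i - 1) * N = (i - 1) * r + (i - 1) * q * a"
      using assms(5) by (simp add: algebra_simps)
    then have "((i - 1) * N) div a = (i - 1) * q + ((i - 1) * r) div a"
      using assms(1) by (simp only: div_mult_self1)
    also have "((i - 1) * r) div a = ((i - 1) * s) div c"
      using \<open>b > 0\<close> by (simp add: c s mult.left_commute)
    finally have 2: "((i - 1) * N) div a = (i - 1) * q + ((i - 1) * s) div c" .
    have "i * q = (i - 1) * q + q" using i by (cases i) auto
    then show ?thesis
      unfolding alpha_eq_div[OF assms(1,2) i] 1 2 \<beta>_def by simp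
  qed
  show ?thesis
  proof
    assume "r = 0 \<or> r = b"
    then show "unimodal a (alpha a N)"
    proof
      assume "r = 0"
      then have N: "N = q * a" and "q > 0" using assms(2,5) by auto
      \<comment> \<open>Both ends of the interval are multiples of \<open>a\<close>, which leaves
        \<open>q - 1\<close> inside.\<close>
      have "alpha a N i = int q - 1" if i: "i \<in> {1..a}" for i
      proof -
        have "(i * N - 1) div a = i * q - 1"
          using mult_pred_div_mult[OF assms(1), of "i * q" 1] by (simp add: N mult_ac)
        moreover have "((i - 1) * N) div a = (i - 1) * q"
          using assms(1) by (simp add: N)
        moreover have "i * q = (i - 1) * q + q" using i by (cases i) auto
        ultimately show ?thesis
          using alpha_eq_div[OF assms(1,2) i] \<open>q > 0\<close> by simp
      qed
      then show ?thesis using unimodal_constant assms(1) by blast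
    next
      assume "r = b"
      \<comment> \<open>For \<open>s = 1\<close> the two quotients in \<open>\<beta> i\<close>
        coincide, so every entry equals \<open>q\<close>.\<close>
      then have "s = 1" using s \<open>b > 0\<close> by simp
      then show ?thesis
        using unimodal_constant[OF assms(1)] alpha by (simp add: \<beta>_def)
    qed
  next
    assume uni: "unimodal a (alpha a N)"
    show "r = 0 \<or> r = b"
    proof (rule ccontr)
      assume "\<not> (r = 0 \<or> r = b)"
      then have "s \<ge> 2" using s by (cases s) auto
      \<comment> \<open>The least index with \<open>c < i * s\<close>. As \<open>s\<close> does not
        divide \<open>c\<close>, the multiple \<open>c\<close> itself lies strictly between
        \<open>(i - 1) * s\<close> and \<open>i * s\<close>.\<close>
      define i where "i = c div s + 1"
      have "\<not> s dvd c"
        using coprime_common_divisor_nat[OF \<open>coprime c s\<close>, of s] \<open>s \<ge> 2\<close> by auto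
      then have below: "(i - 1) * s < c"
        unfolding i_def by (metis add_diff_cancel_right' div_times_less_eq_dividend dvd_triv_right le_neq_implies_less)
      have above: "c < i * s"
        unfolding i_def using \<open>s \<ge> 2\<close> dividend_less_div_times[of s c] by (simp add: add.commute)
      have "i \<le> c"
        unfolding i_def using \<open>s \<ge> 2\<close> \<open>c > 0\<close> div_less_dividend[of s c] by linarith
      have "\<beta> i \<ge> 1"
      proof -
        have "1 \<le> (i * s - 1) div c"
          using above \<open>c > 0\<close> by (simp add: less_eq_div_iff_mult_less_eq)
        then show ?thesis using below by (simp add: \<beta>_def)
      qed
      \<comment> \<open>Shifting the index by \<open>c\<close> adds \<open>s\<close> to both
        quotients.\<close>
      moreover have "\<beta> (i + c) = \<beta> i"
      proof -
        have "(i + c) * s - 1 = (i * s - 1) + s * c"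
          using above by (simp add: algebra_simps)
        then have "((i + c) * s - 1) div c = s + (i * s - 1) div c"
          using \<open>c > 0\<close> by (simp only: div_mult_self1)
        moreover have "(i + c - 1) * s = (i - 1) * s + s * c"
          by (simp add: i_def algebra_simps)
        then have "((i + c - 1) * s) div c = s + ((i - 1) * s) div c"
          using \<open>c > 0\<close> by (simp only: div_mult_self1)
        ultimately show ?thesis by (simp add: \<beta>_def)
      qed
      \<comment> \<open>The interval from \<open>(c - 1) * s\<close> to \<open>c * s\<close> ends at
        a multiple of \<open>c\<close> and has length \<open>s < c\<close>, so no multiple lies
        inside; both quotients are \<open>s - 1\<close>.\<close>
      moreover have "\<beta> c = 0"
      proof -
        obtain t where t: "s = Suc t" using \<open>s \<ge> 2\<close> by (cases s) auto
        have "c * s - 1 = (c - 1) + t * c"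
          using \<open>c > 0\<close> by (simp add: t mult.commute)
        then have "(c * s - 1) div c = t"
          using \<open>c > 0\<close> by (simp only: div_mult_self1) simp
        moreover have "(c - 1) * s = (c - s) + t * c"
          using \<open>s < c\<close> by (simp add: t diff_mult_distrib mult.commute[of t c])
        then have "((c - 1) * s) div c = t"
          using \<open>c > 0\<close> \<open>s \<ge> 2\<close> by (simp only: div_mult_self1) simp
        ultimately show ?thesis by (simp add: \<beta>_def)
      qed
      moreover have "2 * c \<le> a" using \<open>b \<ge> 2\<close> c by simp
      then have "i \<in> {1..a}" "c \<in> {1..a}" "i + c \<in> {1..a}"
        using \<open>i \<le> c\<close> \<open>c > 0\<close> by (auto simp: i_def)
      ultimately show False
        using unimodal_no_valley[OF uni, of i c "i + c"] \<open>i \<le> c\<close> \<open>s \<ge> 2\<close> by (simp add: alpha)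
    qed
  qed
qed

end
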